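(* Let $k_1,\ldots,k_n$ be positive integers. Then the spherical star $\mathrm{St}(k_1,\ldots,k_n)\subset\mathbb{R}^n$ is an $n$-brick.
   Context: $\overline{B}_m$ denotes the closed unit ball of $\mathbb{R}^m$ centered at the origin. The spherical star of weights $k_1,\ldots,k_n$ is the image $\mathrm{St}(k_1,\ldots,k_n)$ of $\overline{B}_n$ under the map $f:\mathbb{R}^n\to\mathbb{R}^n$, $(x_1,\ldots,x_n)\mapsto(x_1^{k_1},\ldots,x_n^{k_n})$; equivalently it is the set of points with $\sum_i |x_i|^{2/k_i}\le1$ and $x_i\ge0$ for each $i$ with $k_i$ even. An $n$-dimensional semialgebraic set $T\subset\mathbb{R}^n$ is an $m$-brick if there exists a homotopy $H=(H_1,\ldots,H_n):[0,1]\times\overline{B}_m\to T$ such that: (1) each $H_i$ is the restriction to $[0,1]\times\overline{B}_m$ of a polynomial of the ring $\mathcal{C}^0([0,1])[x_1,\ldots,x_m]$, where $\mathcal{C}^0([0,1])$ is the ring of continuous real functions on $[0,1]$; (2) $H(\{0\}\times\overline{B}_m)=T$ and $H(1,\cdot)$ is a constant map; (3) $H(\{t\}\times\overline{B}_m)\subset\operatorname{Int}(T)$ for each $t\in(0,1)$, where $\operatorname{Int}$ is the topological interior in $\mathbb{R}^n$. *)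

theory Defs
  imports "HOL-Analysis.Analysis"
begin

(* Semialgebraic sets: the smallest Boolean algebra of subsets containing the sets p > 0 for p a
   real polynomial.  On real^'n the bounded linear functionals are the linear forms, so
   real_polynomial_function describes exactly the polynomial functions in the coordinates. *)
inductive semialgebraic :: "(real ^ 'n::finite) set \<Rightarrow> bool" where
  pos: "real_polynomial_function p \<Longrightarrow> semialgebraic {x. p x > 0}"
| compl: "semialgebraic S \<Longrightarrow> semialgebraic (- S)"
| inter: "semialgebraic S \<Longrightarrow> semialgebraic T \<Longrightarrow> semialgebraic (S \<inter> T)"
| union: "semialgebraic S \<Longrightarrow> semialgebraic T \<Longrightarrow> semialgebraic (S \<union> T)"

(* The dimension of a semialgebraic set is the largest dimension of a cell in a decomposition of it
   into finitely many cells (copies of open cubes (0,1)^d); equivalently, and independently of the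
   decomposition, the largest d such that it contains a homeomorphic copy of R^d.  Meant for
   semialgebraic T; the empty set has no dimension in this sense. *)
definition contains_cell :: "nat \<Rightarrow> (real ^ 'n::finite) set \<Rightarrow> bool" where
  "contains_cell d T \<longleftrightarrow> (\<exists>C\<subseteq>T. top_of_set C homeomorphic_space Euclidean_space d)"

definition has_dimension :: "(real ^ 'n::finite) set \<Rightarrow> nat \<Rightarrow> bool" where
  "has_dimension T d \<longleftrightarrow> contains_cell d T \<and> (\<forall>e. contains_cell e T \<longrightarrow> e \<le> d)"

(* Restrictions to [0,1] x closed unit ball of elements of C^0([0,1])[x_1,...,x_m]: the index set
   A is a finite set of exponent vectors, c a is the coefficient of the monomial x^a.  The coefficients
   only matter on [0,1]. *)
definition continuous_coeff_polynomial :: "(real \<times> (real ^ 'm::finite) \<Rightarrow> real) \<Rightarrow> bool" where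
  "continuous_coeff_polynomial h \<longleftrightarrow>
     (\<exists>(A :: ('m \<Rightarrow> nat) set) c. finite A \<and> (\<forall>a\<in>A. continuous_on {0..1::real} (c a)) \<and>
        (\<forall>t\<in>{0..1}. \<forall>x\<in>cball 0 1. h (t, x) = (\<Sum>a\<in>A. c a t * (\<Prod>j\<in>UNIV. (x $ j) ^ a j))))"

(* An m-brick in R^n, where m is CARD('m) and n is CARD('n). *)
definition brick :: "'m::finite itself \<Rightarrow> (real ^ 'n::finite) set \<Rightarrow> bool" where
  "brick (_ :: 'm itself) T \<longleftrightarrow>
     semialgebraic T \<and> has_dimension T CARD('n) \<and>
     (\<exists>H :: real \<times> (real ^ 'm) \<Rightarrow> real ^ 'n.
        continuous_on ({0..1} \<times> cball 0 1) H \<and>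
        H ` ({0..1} \<times> cball 0 1) \<subseteq> T \<and>
        (\<forall>i. continuous_coeff_polynomial (\<lambda>z. H z $ i)) \<and>
        H ` ({0} \<times> cball 0 1) = T \<and>
        (\<lambda>x. H (1, x)) constant_on cball 0 1 \<and>
        (\<forall>t\<in>{0<..<1}. H ` ({t} \<times> cball 0 1) \<subseteq> interior T))"

definition spherical_star :: "('n::finite \<Rightarrow> nat) \<Rightarrow> (real ^ 'n) set" where
  "spherical_star k = (\<lambda>x. \<chi> i. (x $ i) ^ k i) ` cball 0 1"

end

theory Submission
  imports Defs "HOL-Homology.Invariance_of_Domain" "HOL-Computational_Algebra.Polynomial_FPS"
begin

text \<open>Let \<open>v\<^sub>i(y)\<close> denote \<open>\<bar>y\<^sub>i\<bar>\<close> to the power \<open>2 / k\<^sub>i\<close>. The spherical star is the set of all \<open>y\<close> with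
\<open>\<Sum>\<^sub>i v\<^sub>i(y) \<le> 1\<close> and \<open>y\<^sub>i \<ge> 0\<close> for even \<open>k\<^sub>i\<close> (lemma \<open>spherical_star_eq\<close>), and where all these
inequalities are strict, \<open>y\<close> is an interior point.

The homotopy starts at the power map on the unit ball. On \<open>v\<^sub>i = x\<^sub>i\<^sup>2\<close> it acts by
\<open>v\<^sub>i \<mapsto> (1 - t) v\<^sub>i\<close> for odd \<open>k\<^sub>i\<close> and by \<open>v\<^sub>i \<mapsto> (1 - t) v\<^sub>i + t / (n + 1)\<close> for even \<open>k\<^sub>i\<close>.
Both maps lift to expressions that are polynomial in \<open>x\<^sub>i\<close> with coefficients continuous in \<open>t\<close>. For
\<open>t > 0\<close> the sum is at most \<open>(1 - t) + t n / (n + 1) < 1\<close> and the coordinates of even weight are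
positive, so the image lies in the interior (lemma \<open>star_homotopy_interior\<close>). At \<open>t = 1\<close> the point
\<open>x\<close> has disappeared from the formula. In particular the interior is nonempty, and the star has full
dimension; that no set in \<open>n\<close>-space has a larger dimension is invariance of domain.

That the star is semialgebraic is an elimination of quantifiers, carried out by Galois conjugation. For
tuples \<open>\<zeta>\<close> of roots of unity with \<open>\<zeta>\<^sub>i ^ k\<^sub>i = 1\<close>, let \<open>a\<^sub>\<zeta> = 1 - \<Sum>\<^sub>i \<zeta>\<^sub>i v\<^sub>i(y)\<close> and
\<open>P\<^sub>y = \<Prod>\<^sub>\<zeta> (1 + a\<^sub>\<zeta> X)\<close>. The power sums of the \<open>a\<^sub>\<zeta>\<close> are real polynomials in \<open>y\<close>, since in the sum
over all \<open>\<zeta>\<close> only monomials in the \<open>k\<^sub>i\<close>-th powers of the \<open>v\<^sub>i\<close> survive; by Newton's identities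
the coefficients of \<open>P\<^sub>y\<close> are real polynomials in \<open>y\<close> as well. Finally, \<open>\<Sum>\<^sub>i v\<^sub>i(y) \<le> 1\<close> holds if
and only if all coefficients of the square of \<open>P\<^sub>y\<close> are nonnegative (lemma \<open>sum_star_gauge_le_1_iff\<close>),
which is a finite conjunction of polynomial inequalities.\<close>

section \<open>Complex expressions that are real polynomials\<close>

text \<open>The polynomials constructed below are products over complex roots of unity, yet turn out to have
real coefficients. This predicate records reality and polynomiality at once, so that both pass
together through sums and products.\<close>

definition real_polynomial_valued :: "(real ^ 'n::finite \<Rightarrow> complex) \<Rightarrow> bool" where
  "real_polynomial_valued g \<longleftrightarrow>
     (\<exists>p. real_polynomial_function p \<and> (\<forall>y. g y = complex_of_real (p y)))"

lemma real_polynomial_valued_of_real: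
  "real_polynomial_function p \<Longrightarrow> real_polynomial_valued (\<lambda>y. of_real (p y))"
  unfolding real_polynomial_valued_def by blast

lemma real_polynomial_valued_const: "real_polynomial_valued (\<lambda>y. of_real c)"
  by (rule real_polynomial_valued_of_real) (rule real_polynomial_function.intros)

lemma real_polynomial_valued_add:
  assumes "real_polynomial_valued f" "real_polynomial_valued g"
  shows "real_polynomial_valued (\<lambda>y. f y + g y)"
  using assms unfolding real_polynomial_valued_def
  by (metis of_real_add real_polynomial_function.intros(3))

lemma real_polynomial_valued_mult:
  assumes "real_polynomial_valued f" "real_polynomial_valued g"
  shows "real_polynomial_valued (\<lambda>y. f y * g y)"
  using assms unfolding real_polynomial_valued_def
  by (metis of_real_mult real_polynomial_function.intros(4))

lemma real_polynomial_valued_diff: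
  assumes "real_polynomial_valued f" "real_polynomial_valued g"
  shows "real_polynomial_valued (\<lambda>y. f y - g y)"
  using assms unfolding real_polynomial_valued_def
  by (metis of_real_diff real_polynomial_function_diff)

lemma real_polynomial_valued_sum:
  assumes "\<And>i. i \<in> A \<Longrightarrow> real_polynomial_valued (f i)"
  shows "real_polynomial_valued (\<lambda>y. \<Sum>i\<in>A. f i y)"
  using assms
proof (induction A rule: infinite_finite_induct)
  case (insert i A)
  then show ?case by (simp add: real_polynomial_valued_add)
qed (use real_polynomial_valued_const[of 0] in auto)

lemma real_polynomial_valued_prod:
  assumes "\<And>i. i \<in> A \<Longrightarrow> real_polynomial_valued (f i)"
  shows "real_polynomial_valued (\<lambda>y. \<Prod>i\<in>A. f i y)"
  using assms
proof (induction A rule: infinite_finite_induct)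
  case (insert i A)
  then show ?case by (simp add: real_polynomial_valued_mult)
qed (use real_polynomial_valued_const[of 1] in auto)

section \<open>Power sums over tuples of roots of unity\<close>

text \<open>Multiplication by a primitive root \<open>\<omega>\<close> permutes the roots of unity, so the sum is equal to
\<open>\<omega> ^ a\<close> times itself, and \<open>\<omega> ^ a \<noteq> 1\<close>.\<close>

lemma sum_power_roots_unity_eq_0:
  assumes n: "0 < n" and ndvd: "\<not> n dvd a"
  shows "(\<Sum>z | z ^ n = (1::complex). z ^ a) = 0"
proof -
  let ?U = "{z. z ^ n = (1::complex)}"
  define \<omega> where "\<omega> = cis (2 * pi / real n)"
  have \<omega>n: "\<omega> ^ n = 1" using n by (simp add: \<omega>_def Complex.DeMoivre)
  have \<omega>0: "\<omega> \<noteq> 0" by (simp add: \<omega>_def)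
  have \<omega>a: "\<omega> ^ a \<noteq> 1"
  proof
    define r where "r = a mod n"
    have r: "r < n" "r \<noteq> 0" using n ndvd by (auto simp: r_def dvd_eq_mod_eq_0)
    assume "\<omega> ^ a = 1"
    moreover have "\<omega> ^ a = (\<omega> ^ n) ^ (a div n) * \<omega> ^ r"
      by (simp add: r_def flip: power_mult power_add)
    ultimately have "\<omega> ^ r = 1" by (simp add: \<omega>n)
    moreover have "\<omega> ^ j = cis (2 * pi * real j / real n)" for j
      by (simp add: \<omega>_def Complex.DeMoivre mult_ac)
    moreover have "inj_on (\<lambda>j. cis (2 * pi * real j / real n)) {..<n}"
      using Complex.bij_betw_roots_unity[OF n] by (rule bij_betw_imp_inj_on)
    ultimately show False
      using r n inj_onD[of _ "{..<n}" r 0] by fastforce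
  qed
  have "(\<Sum>z\<in>?U. z ^ a) = (\<Sum>z\<in>?U. (\<omega> * z) ^ a)"
    by (rule sum.reindex_bij_witness[of _ "\<lambda>z. \<omega> * z" "\<lambda>z. z / \<omega>"])
       (auto simp: \<omega>0 \<omega>n power_mult_distrib power_divide)
  also have "\<dots> = \<omega> ^ a * (\<Sum>z\<in>?U. z ^ a)"
    by (simp add: power_mult_distrib sum_distrib_left)
  finally show ?thesis using \<omega>a by simp
qed

definition unity_tuples :: "('n::finite \<Rightarrow> nat) \<Rightarrow> ('n \<Rightarrow> complex) set" where
  "unity_tuples k = (\<Pi>\<^sub>E i\<in>UNIV. {z. z ^ k i = 1})"

text \<open>This is \<open>\<bar>y\<^sub>i\<bar>\<close> to the power \<open>2 / k\<^sub>i\<close>; the star is cut out by the condition that these numbers have sum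
at most 1, together with sign conditions for even weights. Written as a \<open>k\<^sub>i\<close>-th root of a square, the number has a \<open>k\<^sub>i\<close>-th power that is polynomial in
\<open>y\<close> without absolute values.\<close>

definition star_gauge :: "('n::finite \<Rightarrow> nat) \<Rightarrow> real ^ 'n \<Rightarrow> 'n \<Rightarrow> real" where
  "star_gauge k y i = root (k i) ((y $ i)\<^sup>2)"

lemma finite_unity_tuples: "(\<And>i. 0 < k i) \<Longrightarrow> finite (unity_tuples k)"
  unfolding unity_tuples_def by (intro finite_PiE) (auto intro: finite_roots_unity simp: Suc_le_eq)

text \<open>The sum over tuples factors into sums over one coordinate each. By orthogonality, a factor vanishes
unless \<open>k\<^sub>i\<close> divides the exponent, and then it contains only powers of the \<open>k\<^sub>i\<close>-th power of the gauge,
that is, of the square of \<open>y\<^sub>i\<close>.\<close>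

lemma unity_monomial_sum_polynomial:
  fixes k :: "'n::finite \<Rightarrow> nat"
  assumes k: "\<And>i. 0 < k i"
  shows "real_polynomial_valued
           (\<lambda>y. \<Sum>\<zeta>\<in>unity_tuples k. \<Prod>i\<in>UNIV. (\<zeta> i * of_real (star_gauge k y i)) ^ a i)"
proof -
  have factor: "(\<Sum>z | z ^ k i = 1. (z * complex_of_real (star_gauge k y i)) ^ a i)
      = of_real (if k i dvd a i then real (k i) * ((y $ i)\<^sup>2) ^ (a i div k i) else 0)" for y i
  proof (cases "k i dvd a i")
    case True
    then obtain b where b: "a i = k i * b" by auto
    have "star_gauge k y i ^ k i = (y $ i)\<^sup>2"
      unfolding star_gauge_def by (rule real_root_pow_pos2) (auto simp: k)
    then have "(z * complex_of_real (star_gauge k y i)) ^ a i = of_real (((y $ i)\<^sup>2) ^ b)"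
      if "z ^ k i = 1" for z
      using that unfolding b power_mult by (simp add: power_mult_distrib flip: of_real_power)
    then have "(\<Sum>z | z ^ k i = 1. (z * complex_of_real (star_gauge k y i)) ^ a i)
        = (\<Sum>z | z ^ k i = (1::complex). of_real (((y $ i)\<^sup>2) ^ b))"
      by (intro sum.cong) auto
    then show ?thesis using k[of i] by (simp add: b card_roots_unity_eq)
  next
    case False
    then show ?thesis
      using sum_power_roots_unity_eq_0[OF k False]
      by (simp add: power_mult_distrib flip: sum_distrib_right)
  qed
  have eq: "(\<Sum>\<zeta>\<in>unity_tuples k. \<Prod>i\<in>UNIV. (\<zeta> i * of_real (star_gauge k y i)) ^ a i)
    = (\<Prod>i\<in>UNIV. of_real (if k i dvd a i then real (k i) * ((y $ i)\<^sup>2) ^ (a i div k i) else 0))" for y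
    unfolding unity_tuples_def factor[symmetric]
    by (rule prod_sum_PiE[symmetric]) (auto intro: finite_roots_unity simp: k Suc_le_eq)
  have "real_polynomial_function
          (\<lambda>y. if k i dvd a i then real (k i) * ((y $ i)\<^sup>2) ^ (a i div k i) else 0)" for i
  proof -
    have "real_polynomial_function (\<lambda>y. real (k i) * ((y $ i)\<^sup>2) ^ (a i div k i))"
      by (rule real_polynomial_function.intros(4)[OF real_polynomial_function.intros(2)
            real_polynomial_function_power[OF real_polynomial_function_power[OF
              real_polynomial_function.intros(1)[OF bounded_linear_vec_nth]]]])
    then show ?thesis
      by (cases "k i dvd a i") (simp_all add: real_polynomial_function.intros(2))
  qed
  then show ?thesis
    unfolding eq by (intro real_polynomial_valued_prod) (rule real_polynomial_valued_of_real)
qed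

text \<open>At the tuple of ones this is the slack of the inequality that defines the star. The other tuples
give the algebraic conjugates of that slack over the field of complex rational functions in the
squares \<open>y\<^sub>i\<^sup>2\<close>.\<close>

definition conjugate_slack :: "('n::finite \<Rightarrow> nat) \<Rightarrow> real ^ 'n \<Rightarrow> ('n \<Rightarrow> complex) \<Rightarrow> complex" where
  "conjugate_slack k y \<zeta> = 1 - (\<Sum>i\<in>UNIV. \<zeta> i * of_real (star_gauge k y i))"

text \<open>Symmetric functions of the conjugates involve no roots any more. For power sums this is seen by
expanding the power one factor at a time; each factor only multiplies monomials by monomials, which
is why the induction carries an arbitrary monomial along.\<close>

lemma slack_power_sum_polynomial:
  fixes k :: "'n::finite \<Rightarrow> nat"
  assumes k: "\<And>i. 0 < k i"
  shows "real_polynomial_valued (\<lambda>y. \<Sum>\<zeta>\<in>unity_tuples k. conjugate_slack k y \<zeta> ^ m)"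
proof -
  let ?M = "\<lambda>a y \<zeta>. \<Prod>i\<in>UNIV. (\<zeta> i * complex_of_real (star_gauge k y i)) ^ a i"
  have "real_polynomial_valued (\<lambda>y. \<Sum>\<zeta>\<in>unity_tuples k. conjugate_slack k y \<zeta> ^ m * ?M a y \<zeta>)" for a
  proof (induction m arbitrary: a)
    case 0
    then show ?case using unity_monomial_sum_polynomial[OF k] by simp
  next
    case (Suc m)
    let ?up = "\<lambda>j. a(j := Suc (a j))"
    have up: "?M (?up j) y \<zeta> = (\<zeta> j * of_real (star_gauge k y j)) * ?M a y \<zeta>" for j y \<zeta>
      by (subst (1 2) prod.remove[of _ j]) (auto intro!: prod.cong)
    have "conjugate_slack k y \<zeta> ^ Suc m * ?M a y \<zeta> = conjugate_slack k y \<zeta> ^ m * ?M a y \<zeta>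
        - (\<Sum>j\<in>UNIV. conjugate_slack k y \<zeta> ^ m * ?M (?up j) y \<zeta>)" for y \<zeta>
    proof -
      have "conjugate_slack k y \<zeta> * ?M a y \<zeta> = ?M a y \<zeta> - (\<Sum>j\<in>UNIV. ?M (?up j) y \<zeta>)"
        unfolding up by (simp add: conjugate_slack_def left_diff_distrib sum_distrib_right)
      then show ?thesis
        by (simp add: right_diff_distrib sum_distrib_left mult.assoc mult.left_commute[of "conjugate_slack k y \<zeta>"])
    qed
    then have "(\<Sum>\<zeta>\<in>unity_tuples k. conjugate_slack k y \<zeta> ^ Suc m * ?M a y \<zeta>)
        = (\<Sum>\<zeta>\<in>unity_tuples k. conjugate_slack k y \<zeta> ^ m * ?M a y \<zeta>)
        - (\<Sum>j\<in>UNIV. \<Sum>\<zeta>\<in>unity_tuples k. conjugate_slack k y \<zeta> ^ m * ?M (?up j) y \<zeta>)" for y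
      by (simp only: sum_subtractf sum.swap[of _ UNIV "unity_tuples k"])
    then show ?case
      by (simp only:) (intro real_polynomial_valued_diff real_polynomial_valued_sum Suc.IH)
  qed
  from this[of "\<lambda>_. 0"] show ?thesis by simp
qed

section \<open>Newton's identities\<close>

text \<open>The logarithmic derivative of the product is the sum of the logarithmic derivatives
\<open>a z / (1 + a z X)\<close> of the factors, and each of these is a geometric series. As a differential
equation this determines all coefficients of the product recursively from the power sums.\<close>

lemma newton_identity:
  fixes a :: "'b \<Rightarrow> complex"
  assumes "finite A"
  shows "fps_deriv (\<Prod>z\<in>A. 1 + fps_const (a z) * fps_X)
       = (\<Prod>z\<in>A. 1 + fps_const (a z) * fps_X) * Abs_fps (\<lambda>m. (-1) ^ m * (\<Sum>z\<in>A. a z ^ Suc m))"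
  using assms
proof (induction A)
  case empty
  then show ?case by (simp add: fps_eq_iff)
next
  case (insert z A)
  let ?L = "1 + fps_const (a z) * fps_X" and ?P = "\<Prod>z\<in>A. 1 + fps_const (a z) * fps_X"
  define G where "G = Abs_fps (\<lambda>m. (-1) ^ m * a z ^ Suc m)"
  define S where "S = Abs_fps (\<lambda>m. (-1) ^ m * (\<Sum>z\<in>A. a z ^ Suc m))"
  have G: "?L * G = fps_const (a z)"
  proof (rule fps_ext)
    fix m show "fps_nth (?L * G) m = fps_nth (fps_const (a z)) m"
      by (cases m) (simp_all add: G_def distrib_right mult.assoc)
  qed
  have split: "Abs_fps (\<lambda>m. (-1) ^ m * (\<Sum>z\<in>insert z A. a z ^ Suc m)) = G + S"
    using insert.hyps by (simp add: G_def S_def fps_eq_iff distrib_left)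
  have "fps_deriv (?L * ?P) = fps_const (a z) * ?P + ?L * (?P * S)"
    using insert.IH by (simp add: S_def add.commute)
  also have "\<dots> = (?L * G) * ?P + ?L * (?P * S)"
    by (simp only: G)
  also have "\<dots> = (?L * ?P) * (G + S)"
    by (metis (no_types, lifting) distrib_left mult.assoc mult.commute)
  finally show ?case using insert.hyps split by simp
qed

text \<open>Newton's identities express the coefficient of index \<open>m + 1\<close>, multiplied by \<open>m + 1\<close>, by the
power sums and the coefficients of smaller index; dividing by \<open>m + 1\<close> stays within real
polynomials.\<close>

lemma elementary_symmetric_polynomial:
  fixes a :: "real ^ 'n::finite \<Rightarrow> 'b \<Rightarrow> complex"
  assumes A: "finite A" and pow: "\<And>m. real_polynomial_valued (\<lambda>y. \<Sum>z\<in>A. a y z ^ m)"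
  shows "real_polynomial_valued (\<lambda>y. poly.coeff (\<Prod>z\<in>A. [:1, a y z:]) j)"
proof -
  let ?F = "\<lambda>y. \<Prod>z\<in>A. 1 + fps_const (a y z) * fps_X"
  have "real_polynomial_valued (\<lambda>y. fps_nth (?F y) j)"
  proof (induction j rule: less_induct)
    case (less j)
    show ?case
    proof (cases j)
      case 0
      have "fps_nth (?F y) 0 = 1" for y
        using A by (induction A) simp_all
      with 0 show ?thesis using real_polynomial_valued_const[of 1] by simp
    next
      case (Suc m)
      have "of_nat (Suc m) * fps_nth (?F y) (Suc m)
          = (\<Sum>i=0..m. fps_nth (?F y) i * ((-1) ^ (m - i) * (\<Sum>z\<in>A. a y z ^ Suc (m - i))))" for y
        using arg_cong[OF newton_identity[OF A, of "a y"], of "\<lambda>f. fps_nth f m"]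
        by (simp add: fps_mult_nth del: of_nat_Suc)
      then have "fps_nth (?F y) j = of_real (1 / real (Suc m)) *
          (\<Sum>i=0..m. fps_nth (?F y) i * (of_real ((-1) ^ (m - i)) * (\<Sum>z\<in>A. a y z ^ Suc (m - i))))" for y
        unfolding Suc by (simp add: field_simps del: of_nat_Suc power_Suc)
      then show ?thesis
        by (simp only:) (intro real_polynomial_valued_mult real_polynomial_valued_sum
            real_polynomial_valued_const pow less.IH, auto simp: Suc)
    qed
  qed
  moreover have "poly.coeff (\<Prod>z\<in>A. [:1, a y z:]) j = fps_nth (?F y) j" for y
    by (simp add: fps_of_poly_prod fps_of_poly_pCons flip: fps_of_poly_nth)
  ultimately show ?thesis by simp
qed

section \<open>Nonnegative coefficients and the location of roots\<close>

definition nonneg_coeffs :: "complex poly \<Rightarrow> bool" where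
  "nonneg_coeffs p \<longleftrightarrow> (\<forall>j. poly.coeff p j \<in> \<real>\<^sub>\<ge>\<^sub>0)"

lemma nonneg_coeffs_mult:
  assumes "nonneg_coeffs p" "nonneg_coeffs q"
  shows "nonneg_coeffs (p * q)"
proof -
  have "(\<Sum>i\<in>B. g i) \<in> \<real>\<^sub>\<ge>\<^sub>0" if "\<And>i. i \<in> B \<Longrightarrow> g i \<in> \<real>\<^sub>\<ge>\<^sub>0" for B and g :: "nat \<Rightarrow> complex"
    using that by (induction B rule: infinite_finite_induct) simp_all
  then show ?thesis using assms by (simp add: nonneg_coeffs_def coeff_mult)
qed

lemma nonneg_coeffs_prod:
  assumes "\<And>i. i \<in> A \<Longrightarrow> nonneg_coeffs (f i)"
  shows "nonneg_coeffs (\<Prod>i\<in>A. f i)"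
  using assms
proof (induction A rule: infinite_finite_induct)
  case (insert i A)
  then show ?case by (simp add: nonneg_coeffs_mult)
qed (auto simp: nonneg_coeffs_def coeff_1)

text \<open>A real polynomial is its own conjugate, so its square is a product of the real quadratics
\<open>(1 + a X) (1 + cnj a X) = 1 + 2 Re(a) X + \<bar>a\<bar>\<^sup>2 X\<^sup>2\<close>. Squaring makes it unnecessary to match the
nonreal roots into conjugate pairs.\<close>

lemma half_plane_roots_imp_nonneg_coeffs:
  fixes a :: "'b \<Rightarrow> complex"
  assumes re: "\<And>z. z \<in> A \<Longrightarrow> 0 \<le> Re (a z)"
    and real: "\<And>j. poly.coeff (\<Prod>z\<in>A. [:1, a z:]) j \<in> \<real>"
  shows "nonneg_coeffs ((\<Prod>z\<in>A. [:1, a z:])\<^sup>2)"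
proof -
  let ?P = "\<Prod>z\<in>A. [:1, a z:]"
  have "map_poly cnj ?P = ?P"
    using real by (intro poly_eqI) (auto simp: coeff_map_poly Reals_cnj_iff)
  moreover have "map_poly cnj ?P = (\<Prod>z\<in>A. [:1, cnj (a z):])"
  proof -
    have "map_poly cnj (p * q) = map_poly cnj p * map_poly cnj q" for p q
      by (intro poly_eqI) (simp add: coeff_map_poly coeff_mult)
    then show ?thesis
      by (induction A rule: infinite_finite_induct) (simp_all add: map_poly_pCons del: mult_pCons_left)
  qed
  ultimately have "?P\<^sup>2 = (\<Prod>z\<in>A. [:1, a z:] * [:1, cnj (a z):])"
    by (simp only: power2_eq_square prod.distrib)
  moreover have "nonneg_coeffs ([:1, a z:] * [:1, cnj (a z):])" if "z \<in> A" for z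
  proof -
    have "[:1, a z:] * [:1, cnj (a z):] = [:1, of_real (2 * Re (a z)), of_real ((cmod (a z))\<^sup>2):]"
      by (simp add: complex_add_cnj cmod_power2 mult.commute[of "cnj (a z)"] complex_mult_cnj)
    then show ?thesis
      using re[OF that] by (auto simp: nonneg_coeffs_def coeff_pCons split: nat.split)
  qed
  ultimately show ?thesis by (simp add: nonneg_coeffs_prod)
qed

section \<open>Spherical stars are semialgebraic\<close>

lemma semialgebraic_nonneg:
  assumes "real_polynomial_function p"
  shows "semialgebraic {y. 0 \<le> p y}"
proof -
  have "{y. 0 \<le> p y} = - {y. - p y > 0}" by auto
  moreover have "semialgebraic {y. - p y > 0}"
    using assms by (intro semialgebraic.pos real_polynomial_function_minus)
  ultimately show ?thesis by (metis semialgebraic.compl)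
qed

lemma semialgebraic_INT:
  assumes "finite I" "\<And>i. i \<in> I \<Longrightarrow> semialgebraic (S i)"
  shows "semialgebraic (\<Inter>i\<in>I. S i :: (real ^ 'n::finite) set)"
  using assms
proof (induction I)
  case empty
  have "semialgebraic {y :: real ^ 'n. 1 > (0::real)}"
    by (intro semialgebraic.pos real_polynomial_function.intros(2))
  then show ?case by simp
next
  case (insert i I)
  then show ?case by (auto intro: semialgebraic.inter)
qed

lemma star_gauge_nonneg: "0 < k i \<Longrightarrow> 0 \<le> star_gauge k y i"
  by (simp add: star_gauge_def)

lemma star_gauge_powers:
  assumes "0 < k i"
  shows "star_gauge k (\<chi> i. (x $ i) ^ k i) i = (x $ i)\<^sup>2"
  using assms by (simp add: star_gauge_def real_root_power_cancel flip: power_mult)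
     (simp add: mult.commute[of "k i"] power_mult real_root_power_cancel)

text \<open>Solving \<open>y\<^sub>i = x\<^sub>i ^ k\<^sub>i\<close> by \<open>x\<^sub>i = root k\<^sub>i y\<^sub>i\<close> covers both parities: for odd \<open>k\<^sub>i\<close> the root function is
odd, and for even \<open>k\<^sub>i\<close> the number \<open>y\<^sub>i\<close> is nonnegative.\<close>

lemma spherical_star_eq:
  fixes k :: "'n::finite \<Rightarrow> nat"
  assumes k: "\<And>i. 0 < k i"
  shows "spherical_star k =
    {y. (\<Sum>i\<in>UNIV. star_gauge k y i) \<le> 1 \<and> (\<forall>i. even (k i) \<longrightarrow> 0 \<le> y $ i)}" (is "_ = ?R")
proof
  have ball: "x \<in> cball 0 1 \<longleftrightarrow> (\<Sum>i\<in>UNIV. (x $ i)\<^sup>2) \<le> 1" for x :: "real ^ 'n"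
    by (simp add: norm_vec_def L2_set_def)
  show "spherical_star k \<subseteq> ?R"
    using k ball by (auto simp: spherical_star_def star_gauge_powers zero_le_even_power)
  show "?R \<subseteq> spherical_star k"
  proof
    fix y assume y: "y \<in> ?R"
    define x where "x = (\<chi> i. root (k i) (y $ i))"
    have "(x $ i) ^ k i = y $ i" for i
      using y k[of i] by (cases "even (k i)") (auto simp: x_def odd_real_root_pow)
    then have "y = (\<chi> i. (x $ i) ^ k i)" by (simp add: vec_eq_iff)
    moreover have "(x $ i)\<^sup>2 = star_gauge k y i" for i
      using k by (simp add: x_def star_gauge_def real_root_power)
    then have "x \<in> cball 0 1" unfolding ball using y by simp
    ultimately show "y \<in> spherical_star k" unfolding spherical_star_def by blast
  qed
qed

definition slack_polynomial :: "('n::finite \<Rightarrow> nat) \<Rightarrow> real ^ 'n \<Rightarrow> complex poly" where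
  "slack_polynomial k y = (\<Prod>\<zeta>\<in>unity_tuples k. [:1, conjugate_slack k y \<zeta>:])"

lemma slack_polynomial_coeffs_polynomial:
  assumes "\<And>i. 0 < k i"
  shows "real_polynomial_valued (\<lambda>y. poly.coeff (slack_polynomial k y) j)"
    and "real_polynomial_valued (\<lambda>y. poly.coeff ((slack_polynomial k y)\<^sup>2) j)"
proof -
  show *: "real_polynomial_valued (\<lambda>y. poly.coeff (slack_polynomial k y) j)" for j
    unfolding slack_polynomial_def using assms
    by (intro elementary_symmetric_polynomial finite_unity_tuples slack_power_sum_polynomial)
  show "real_polynomial_valued (\<lambda>y. poly.coeff ((slack_polynomial k y)\<^sup>2) j)"
    unfolding power2_eq_square coeff_mult
    by (intro real_polynomial_valued_sum real_polynomial_valued_mult *)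
qed

lemma nonneg_coeffs_no_nonneg_root:
  assumes nn: "nonneg_coeffs p" and c0: "poly.coeff p 0 = 1" and x: "0 \<le> x"
  shows "poly p (complex_of_real x) \<noteq> 0"
proof -
  have nn': "0 \<le> Re (poly.coeff p j)" "poly.coeff p j = of_real (Re (poly.coeff p j))" for j
    using nn by (auto simp: nonneg_coeffs_def complex_nonneg_Reals_iff complex_eq_iff)
  have "poly p (of_real x) = of_real (\<Sum>j\<le>degree p. Re (poly.coeff p j) * x ^ j)"
    unfolding poly_altdef of_real_sum
    by (intro sum.cong refl) (metis nn'(2) of_real_mult of_real_power)
  moreover have "Re (poly.coeff p 0) * x ^ 0 \<le> (\<Sum>j\<le>degree p. Re (poly.coeff p j) * x ^ j)"
    by (rule member_le_sum) (use nn' x in auto)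
  ultimately show ?thesis using c0 by (simp del: of_real_sum)
qed

text \<open>The condition with roots becomes a condition without roots. Among the conjugates of the sum of the
gauges, the sum itself has the largest modulus, because roots of unity have modulus 1. So if it is at
most 1, then all conjugates of the slack have nonnegative real part and the squared polynomial has
nonnegative coefficients. If the sum is \<open>s > 1\<close>, then the factor at the tuple of ones is
\<open>1 - (s - 1) X\<close>, which has the positive root \<open>1 / (s - 1)\<close>; no polynomial with
constant term 1 and nonnegative coefficients has such a root.\<close>

lemma sum_star_gauge_le_1_iff:
  fixes k :: "'n::finite \<Rightarrow> nat"
  assumes k: "\<And>i. 0 < k i"
  shows "(\<Sum>i\<in>UNIV. star_gauge k y i) \<le> 1 \<longleftrightarrow> nonneg_coeffs ((slack_polynomial k y)\<^sup>2)"
proof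
  assume le: "(\<Sum>i\<in>UNIV. star_gauge k y i) \<le> 1"
  have "0 \<le> Re (conjugate_slack k y \<zeta>)" if "\<zeta> \<in> unity_tuples k" for \<zeta>
  proof -
    have "cmod (\<zeta> i) = 1" for i
      using that k[of i] power_eq_1_iff[of "\<zeta> i" "k i"] by (auto simp: unity_tuples_def PiE_iff)
    then have "cmod (\<Sum>i\<in>UNIV. \<zeta> i * of_real (star_gauge k y i)) \<le> (\<Sum>i\<in>UNIV. star_gauge k y i)"
      using star_gauge_nonneg[OF k]
      by (intro sum_norm_le) (simp add: norm_mult)
    then have "Re (\<Sum>i\<in>UNIV. \<zeta> i * of_real (star_gauge k y i)) \<le> 1"
      using le by (intro order_trans[OF complex_Re_le_cmod]) simp
    then show ?thesis by (simp add: conjugate_slack_def)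
  qed
  moreover have "poly.coeff (slack_polynomial k y) j \<in> \<real>" for j
    using slack_polynomial_coeffs_polynomial(1)[of k j] k by (auto simp: real_polynomial_valued_def)
  ultimately show "nonneg_coeffs ((slack_polynomial k y)\<^sup>2)"
    unfolding slack_polynomial_def by (intro half_plane_roots_imp_nonneg_coeffs)
next
  assume nn: "nonneg_coeffs ((slack_polynomial k y)\<^sup>2)"
  show "(\<Sum>i\<in>UNIV. star_gauge k y i) \<le> 1"
  proof (rule ccontr)
    define s where "s = (\<Sum>i\<in>UNIV. star_gauge k y i)"
    assume "\<not> (\<Sum>i\<in>UNIV. star_gauge k y i) \<le> 1"
    then have s: "1 < s" by (simp add: s_def)
    have one: "(\<lambda>_. 1) \<in> unity_tuples k" by (simp add: unity_tuples_def PiE_UNIV_domain)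
    have "conjugate_slack k y (\<lambda>_. 1) = of_real (1 - s)"
      by (simp add: conjugate_slack_def s_def)
    then have "poly [:1, conjugate_slack k y (\<lambda>_. 1):] (of_real (1 / (s - 1))) = of_real (1 + (1 - s) / (s - 1))"
      by simp
    also have "1 + (1 - s) / (s - 1) = 0" using s by (simp add: field_simps)
    finally have "poly (slack_polynomial k y) (of_real (1 / (s - 1))) = 0"
      unfolding slack_polynomial_def poly_prod
      using one finite_unity_tuples[of k] k by (intro prod_zero) auto
    then have "poly ((slack_polynomial k y)\<^sup>2) (of_real (1 / (s - 1))) = 0" by simp
    moreover have "poly.coeff ((slack_polynomial k y)\<^sup>2) 0 = 1"
      by (simp add: slack_polynomial_def poly_prod flip: poly_0_coeff_0)
    ultimately show False using nonneg_coeffs_no_nonneg_root[OF nn, of "1 / (s - 1)"] s by simp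
  qed
qed

lemma semialgebraic_spherical_star:
  fixes k :: "'n::finite \<Rightarrow> nat"
  assumes k: "\<And>i. 0 < k i"
  shows "semialgebraic (spherical_star k)"
proof -
  obtain p where p: "\<And>j. real_polynomial_function (p j)"
    and p_eq: "\<And>j y. poly.coeff ((slack_polynomial k y)\<^sup>2) j = complex_of_real (p j y)"
    using slack_polynomial_coeffs_polynomial(2)[of k] k
    unfolding real_polynomial_valued_def by metis
  define N where "N = 2 * card (unity_tuples k)"
  \<comment> \<open>A bound uniform in \<open>y\<close> leaves finitely many coefficients to test.\<close>
  have deg: "degree ((slack_polynomial k y)\<^sup>2) \<le> N" for y
  proof -
    have "degree (slack_polynomial k y) \<le> (\<Sum>\<zeta>\<in>unity_tuples k. degree [:1, conjugate_slack k y \<zeta>:])"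
      unfolding slack_polynomial_def using degree_prod_sum_le[of "unity_tuples k"] finite_unity_tuples[of k] k
      by (metis (no_types, lifting) comp_def sum.cong)
    also have "\<dots> \<le> (\<Sum>\<zeta>\<in>unity_tuples k. 1)" by (intro sum_mono) simp
    finally show ?thesis
      unfolding N_def by (intro order_trans[OF degree_power_le]) simp
  qed
  have "nonneg_coeffs ((slack_polynomial k y)\<^sup>2) \<longleftrightarrow> (\<forall>j\<le>N. 0 \<le> p j y)" for y
  proof -
    have "0 \<le> p j y" if "N < j" for j
      using p_eq[of y j] coeff_eq_0[of "(slack_polynomial k y)\<^sup>2" j] deg[of y] that by simp
    then show ?thesis by (auto simp: nonneg_coeffs_def p_eq not_le) (meson not_le)
  qed
  then have "spherical_star k =
     (\<Inter>j\<in>{..N}. {y. 0 \<le> p j y}) \<inter> (\<Inter>i\<in>{i. even (k i)}. {y. 0 \<le> y $ i})"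
    unfolding spherical_star_eq[OF k] sum_star_gauge_le_1_iff[OF k] by auto
  also have "semialgebraic \<dots>"
    by (intro semialgebraic.inter semialgebraic_INT semialgebraic_nonneg p finite_atMost finite
        real_polynomial_function.intros(1) bounded_linear_vec_nth)
  finally show ?thesis .
qed

section \<open>Dimension\<close>

text \<open>Invariance of domain. If a cell of dimension \<open>e > n\<close> lay in \<open>n\<close>-space, then \<open>e\<close>-space would embed
continuously into its own subspace \<open>n\<close>-space, and the image would be open in \<open>e\<close>-space. But a line
in the direction of the coordinate of index \<open>n\<close> (indices start at 0, so \<open>n\<close>-space is where this and
all later coordinates vanish) meets \<open>n\<close>-space in only one point.\<close>

lemma contains_cell_imp_le:
  fixes T :: "(real ^ 'n::finite) set"
  assumes "contains_cell e T"
  shows "e \<le> CARD('n)"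
proof (rule ccontr)
  let ?n = "CARD('n)" and ?E = Euclidean_space
  assume "\<not> e \<le> ?n"
  then have ne: "?n < e" by simp
  obtain C where "top_of_set C homeomorphic_space ?E e" "C \<subseteq> T"
    using assms by (auto simp: contains_cell_def)
  then obtain h where h: "homeomorphic_map (?E e) (top_of_set C) h"
    by (metis homeomorphic_space homeomorphic_space_sym)
  obtain g' and g :: "real ^ 'n \<Rightarrow> nat \<Rightarrow> real" where gg: "homeomorphic_maps (?E DIM(real ^ 'n)) euclidean g' g"
    by (rule homeomorphic_maps_Euclidean_space_euclidean)
  have g: "continuous_map euclidean (?E ?n) g" "inj g"
    using gg by (auto simp: homeomorphic_maps_def intro: inj_on_inverseI)
  define f where "f = g \<circ> h"
  let ?U = "topspace (?E e)"
  have "continuous_map (?E e) euclidean h"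
    using homeomorphic_imp_continuous_map[OF h] by (simp add: continuous_map_in_subtopology)
  then have f: "continuous_map (?E e) (?E ?n) f"
    unfolding f_def using g(1) by (rule continuous_map_compose)
  have "inj_on f ?U"
    unfolding f_def using homeomorphic_imp_injective_map[OF h] g(2)
    by (intro comp_inj_on) (auto intro: inj_on_subset)
  moreover have "continuous_map (?E e) (?E e) f"
    using f ne unfolding Euclidean_space_def continuous_map_in_subtopology
    by (simp add: Pi_iff)
  ultimately have op: "openin (?E e) (f ` ?U)"
    by (intro invariance_of_domain_Euclidean_space) auto
  have fU: "f ` ?U \<subseteq> topspace (?E ?n)"
    using f by (rule continuous_map_image_subset_topspace)
  define p where "p = f (\<lambda>_. 0)"
  have p: "p \<in> f ` ?U" by (auto simp: p_def topspace_Euclidean_space)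
  define \<gamma> where "\<gamma> = (\<lambda>(s::real) i. if i < e then (if i = ?n then s else p i) else 0)"
  have "continuous_map euclideanreal (?E e) \<gamma>"
    unfolding \<gamma>_def continuous_map_componentwise_Euclidean_space by auto
  then have "open {s. \<gamma> s \<in> f ` ?U}"
    using openin_continuous_map_preimage[OF _ op] by fastforce
  moreover have "{s. \<gamma> s \<in> f ` ?U} = {0}"
  proof -
    have "s = 0" if "\<gamma> s \<in> f ` ?U" for s
    proof -
      have "\<gamma> s \<in> topspace (?E ?n)" using that fU by blast
      then have "\<gamma> s ?n = 0" by (simp add: topspace_Euclidean_space)
      then show ?thesis using ne by (simp add: \<gamma>_def)
    qed
    moreover have "p i = 0" if "?n \<le> i" for i
      using p fU that by (auto simp: topspace_Euclidean_space)
    then have "\<gamma> 0 = p"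
      using ne by (simp add: \<gamma>_def fun_eq_iff)
    ultimately show ?thesis using p by auto
  qed
  ultimately show False using not_open_singleton[of "0::real"] by simp
qed

lemma has_dimension_if_interior_nonempty:
  fixes T :: "(real ^ 'n::finite) set"
  assumes "interior T \<noteq> {}"
  shows "has_dimension T CARD('n)"
proof -
  obtain a r where r: "0 < r" "ball a r \<subseteq> T"
    using assms by (auto simp: mem_interior)
  have "top_of_set (ball a r) homeomorphic_space (euclidean :: (real ^ 'n) topology)"
    using homeomorphic_ball_UNIV[OF r(1), of a]
    by (simp flip: homeomorphic_space_iff_homeomorphic)
  moreover obtain f g where "homeomorphic_maps (Euclidean_space DIM(real ^ 'n)) (euclidean :: (real ^ 'n) topology) f g"
    by (rule homeomorphic_maps_Euclidean_space_euclidean)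
  then have "(euclidean :: (real ^ 'n) topology) homeomorphic_space Euclidean_space CARD('n)"
    using homeomorphic_space_def homeomorphic_space_sym by fastforce
  ultimately have "contains_cell CARD('n) T"
    unfolding contains_cell_def using r homeomorphic_space_trans by blast
  then show ?thesis unfolding has_dimension_def using contains_cell_imp_le by blast
qed

section \<open>The contracting homotopy\<close>

lemma mem_interior_spherical_star:
  fixes k :: "'n::finite \<Rightarrow> nat"
  assumes k: "\<And>i. 0 < k i"
    and lt: "(\<Sum>i\<in>UNIV. star_gauge k y i) < 1" and pos: "\<And>i. even (k i) \<Longrightarrow> 0 < y $ i"
  shows "y \<in> interior (spherical_star k)"
proof -
  let ?O = "{y. (\<Sum>i\<in>UNIV. star_gauge k y i) < 1} \<inter> (\<Inter>i\<in>{i. even (k i)}. {y. 0 < y $ i})"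
  have "open ?O"
    unfolding star_gauge_def
    by (intro open_Int open_INT ballI open_Collect_less continuous_intros finite)
  moreover have "?O \<subseteq> spherical_star k"
    unfolding spherical_star_eq[OF k] by (auto intro: less_imp_le)
  ultimately show ?thesis using lt pos by (intro interiorI[of ?O]) auto
qed

lemma continuous_coeff_polynomial_univariate:
  fixes h :: "real \<times> (real ^ 'm::finite) \<Rightarrow> real"
  assumes B: "finite B" and c: "\<And>a. a \<in> B \<Longrightarrow> continuous_on {0..1} (c a)"
    and h: "\<And>t x. t \<in> {0..1} \<Longrightarrow> x \<in> cball 0 1 \<Longrightarrow> h (t, x) = (\<Sum>a\<in>B. c a t * (x $ i) ^ a)"
  shows "continuous_coeff_polynomial h"
proof -
  let ?e = "\<lambda>(a::nat) j. if j = i then a else 0"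
  have inj: "inj_on ?e B" by (auto simp: inj_on_def fun_eq_iff split: if_splits)
  have mono: "(\<Prod>j\<in>UNIV. (x $ j) ^ ?e a j) = (x $ i) ^ a" for x :: "real ^ 'm" and a
    by (subst prod.remove[of _ i]) auto
  have "(\<Sum>\<alpha>\<in>?e ` B. c (\<alpha> i) t * (\<Prod>j\<in>UNIV. (x $ j) ^ \<alpha> j)) = (\<Sum>a\<in>B. c a t * (x $ i) ^ a)" for t and x :: "real ^ 'm"
    using inj mono by (simp add: sum.reindex)
  then show ?thesis
    unfolding continuous_coeff_polynomial_def using B c h
    by (intro exI[of _ "?e ` B"] exI[of _ "\<lambda>\<alpha>. c (\<alpha> i)"]) auto
qed

text \<open>At time 0 this is the power map that defines the star. In terms of the gauges, the homotopy shrinks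
all squares \<open>x\<^sub>i\<^sup>2\<close> by the factor \<open>1 - t\<close> and, in the coordinates of even weight, adds a small amount
that keeps the coordinate away from the boundary \<open>y\<^sub>i = 0\<close>. There are at most \<open>n\<close> such
coordinates, so the total added is at most \<open>t n / (n + 1)\<close>, which for \<open>t > 0\<close> is less than the room \<open>t\<close> that
shrinking leaves. For even weights only \<open>x\<^sub>i\<^sup>2\<close> enters the power map, which makes it possible to deform
\<open>x\<^sub>i\<^sup>2\<close> directly and remain polynomial in \<open>x\<^sub>i\<close>.\<close>

definition star_homotopy :: "('n::finite \<Rightarrow> nat) \<Rightarrow> real \<times> (real ^ 'n) \<Rightarrow> real ^ 'n" where
  "star_homotopy k = (\<lambda>(t, x). \<chi> i.
     if even (k i) then ((1 - t) * (x $ i)\<^sup>2 + t / real (CARD('n) + 1)) ^ (k i div 2)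
     else (sqrt (1 - t) * x $ i) ^ k i)"

lemma star_homotopy_component_polynomial:
  fixes k :: "'n::finite \<Rightarrow> nat"
  shows "continuous_coeff_polynomial (\<lambda>z. star_homotopy k z $ i)"
proof (cases "even (k i)")
  case True
  define l where "l = k i div 2"
  define \<delta> where "\<delta> t = t / real (CARD('n) + 1)" for t
  define c where "c a t = real (l choose (a div 2)) * (1 - t) ^ (a div 2) * \<delta> t ^ (l - a div 2)" for a :: nat and t
  have "star_homotopy k (t, x) $ i = (\<Sum>a\<in>(*) 2 ` {..l}. c a t * (x $ i) ^ a)" for t x
  proof -
    have "star_homotopy k (t, x) $ i = ((1 - t) * (x $ i)\<^sup>2 + \<delta> t) ^ l"
      using True by (simp add: star_homotopy_def l_def \<delta>_def)
    also have "\<dots> = (\<Sum>a\<le>l. c (2 * a) t * (x $ i) ^ (2 * a))"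
      unfolding binomial_ring c_def
      by (intro sum.cong) (simp_all add: power_mult_distrib power_mult)
    finally show ?thesis by (simp add: sum.reindex inj_on_def)
  qed
  then show ?thesis
    unfolding c_def \<delta>_def
    by (rule continuous_coeff_polynomial_univariate[rotated 2]) (auto intro!: continuous_intros)
next
  case False
  then have "star_homotopy k (t, x) $ i = (\<Sum>a\<in>{k i}. sqrt (1 - t) ^ k i * (x $ i) ^ a)" for t x
    by (simp add: star_homotopy_def power_mult_distrib)
  then show ?thesis
    by (rule continuous_coeff_polynomial_univariate[rotated 2]) (auto intro!: continuous_intros)
qed

lemma star_homotopy_continuous: "continuous_on X (star_homotopy k)"
proof -
  have "continuous_on X (\<lambda>z. star_homotopy k z $ i)" for i
    by (cases "even (k i)") (auto simp: star_homotopy_def case_prod_unfold intro!: continuous_intros)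
  then show ?thesis using continuous_on_vec_lambda[of X "\<lambda>i z. star_homotopy k z $ i"] by simp
qed

lemma star_homotopy_0: "star_homotopy k (0, x) = (\<chi> i. (x $ i) ^ k i)"
  by (auto simp: star_homotopy_def vec_eq_iff simp flip: power_mult)

lemma star_gauge_star_homotopy:
  fixes k :: "'n::finite \<Rightarrow> nat"
  assumes k: "0 < k i" and t: "t \<in> {0..1}"
  shows "star_gauge k (star_homotopy k (t, x)) i
       = (1 - t) * (x $ i)\<^sup>2 + (if even (k i) then t / real (CARD('n) + 1) else 0)"
proof (cases "even (k i)")
  case True
  define u where "u = (1 - t) * (x $ i)\<^sup>2 + t / real (CARD('n) + 1)"
  have "0 \<le> u" unfolding u_def using t by auto
  moreover have "(star_homotopy k (t, x) $ i)\<^sup>2 = u ^ k i"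
    using True by (simp add: star_homotopy_def u_def flip: power_mult)
  ultimately show ?thesis
    using True k by (simp add: star_gauge_def real_root_power_cancel u_def)
next
  case False
  have "(star_homotopy k (t, x) $ i)\<^sup>2 = ((1 - t) * (x $ i)\<^sup>2) ^ k i"
  proof -
    have "(star_homotopy k (t, x) $ i)\<^sup>2 = ((sqrt (1 - t) * x $ i)\<^sup>2) ^ k i"
      using False by (simp add: star_homotopy_def mult.commute flip: power_mult)
    then show ?thesis using t by (simp add: power_mult_distrib)
  qed
  then show ?thesis using False k t by (simp add: star_gauge_def real_root_power_cancel)
qed

lemma star_homotopy_interior:
  fixes k :: "'n::finite \<Rightarrow> nat"
  assumes k: "\<And>i. 0 < k i" and t: "0 < t" "t \<le> 1" and x: "x \<in> cball 0 1"
  shows "star_homotopy k (t, x) \<in> interior (spherical_star k)"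
proof (rule mem_interior_spherical_star)
  let ?n = "CARD('n)"
  have "(\<Sum>i\<in>UNIV. star_gauge k (star_homotopy k (t, x)) i)
      \<le> (\<Sum>i\<in>UNIV. (1 - t) * (x $ i)\<^sup>2 + t / real (?n + 1))"
    using t by (intro sum_mono) (simp add: star_gauge_star_homotopy k)
  also have "\<dots> = (1 - t) * (\<Sum>i\<in>UNIV. (x $ i)\<^sup>2) + t * (real ?n / real (?n + 1))"
    by (simp add: sum.distrib sum_distrib_left)
  also have "\<dots> \<le> (1 - t) * 1 + t * (real ?n / real (?n + 1))"
    using x t by (intro add_right_mono mult_left_mono) (auto simp: norm_vec_def L2_set_def)
  also have "\<dots> < (1 - t) + t * 1"
    using t by (simp add: field_simps)
  finally show "(\<Sum>i\<in>UNIV. star_gauge k (star_homotopy k (t, x)) i) < 1" by simp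
  fix i assume "even (k i)"
  moreover have "0 < (1 - t) * (x $ i)\<^sup>2 + t / real (?n + 1)"
    using t by (intro add_nonneg_pos) auto
  ultimately show "0 < star_homotopy k (t, x) $ i" by (simp add: star_homotopy_def)
qed (rule k)

theorem corollary2p18:
  fixes k :: "'n::finite \<Rightarrow> nat"
  assumes "\<And>i. 0 < k i"
  shows "brick TYPE('n) (spherical_star k)"
proof -
  let ?H = "star_homotopy k" and ?T = "spherical_star k"
  have zero: "?H ` ({0} \<times> cball 0 1) = ?T"
  proof -
    have "?H ` ({0} \<times> cball 0 1) = (\<lambda>x. ?H (0, x)) ` cball 0 1" by auto
    then show ?thesis by (simp add: spherical_star_def star_homotopy_0)
  qed
  have inner: "?H ` ({t} \<times> cball 0 1) \<subseteq> interior ?T" if "0 < t" "t \<le> 1" for t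
    using star_homotopy_interior[OF assms that] by auto
  have "?H (t, x) \<in> ?T" if "t \<in> {0..1}" "x \<in> cball 0 1" for t x
  proof (cases "t = 0")
    case True
    then show ?thesis using zero that by blast
  next
    case False
    then have "?H (t, x) \<in> interior ?T" using inner[of t] that by auto
    then show ?thesis using interior_subset by blast
  qed
  then have into: "?H ` ({0..1} \<times> cball 0 1) \<subseteq> ?T" by auto
  have const: "(\<lambda>x. ?H (1, x)) constant_on cball 0 1"
    unfolding constant_on_def
    by (rule exI[of _ "?H (1, 0)"]) (auto simp: star_homotopy_def vec_eq_iff)
  have "interior ?T \<noteq> {}"
    using inner[of 1] by auto
  then show ?thesis
    unfolding brick_def using assms zero inner into const
    by (intro conjI exI[of _ ?H] semialgebraic_spherical_star has_dimension_if_interior_nonempty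
        star_homotopy_continuous allI star_homotopy_component_polynomial) auto
qed

end
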